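(* Let $k\ge 2$ be an integer, $p$ an odd prime, and $\mathcal{G}=\langle s,r : r^{2^kp}=s^2=e,\ srs^{-1}=r^{2^{k-1}p-1}\rangle$, and put $u=r^{2^{k-1}p}$. Then the power graph $P(\mathcal{G})$ is the union (on the common vertex set $\mathcal{G}$, vertices with the same name being identified) of the following graphs: (i) the power graph $P(\langle r\rangle)\cong P(\mathbb{Z}_{2^kp})$ on the vertex set $\langle r\rangle$; (ii) $2^{k-1}p$ copies of $K_2$, namely the edges $\{e, sr^{2t}\}$ for $1\le t\le 2^{k-1}p$; (iii) $2^{k-2}p$ copies of the join $P(\langle u\rangle)+K_2$, one for each cyclic subgroup $\langle sr^{2j+1}\rangle$ ($0\le j\le 2^{k-1}p-1$) of order $4$, in which the two generators of $\langle sr^{2j+1}\rangle$ form the $K_2$ and are joined to both vertices $e,u$ of $P(\langle u\rangle)$. In the paper's notation: $P(\mathcal{G}) = P(\mathbb{Z}_{2^kp}) \cup 2^{k-1}p\,K_2 \cup 2^{k-2}p\left(P(\langle r^{2^{k-1}p}\rangle) + K_2\right)$.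
   Context: The power graph $P(\Omega)$ of a group $\Omega$ has vertex set $\Omega$, two distinct vertices being adjacent iff one is an integral power of the other. $K_n$ is the complete graph on $n$ vertices; $n\Gamma$ denotes $n$ copies of $\Gamma$; for graphs $\Gamma_1,\Gamma_2$, the join $\Gamma_1+\Gamma_2$ has vertex set $V(\Gamma_1)\cup V(\Gamma_2)$ and edges those of $\Gamma_1$, those of $\Gamma_2$, and all edges between a vertex of $\Gamma_1$ and a vertex of $\Gamma_2$. *)

theory Defs
  imports "HOL-Algebra.Elementary_Groups" "HOL-Computational_Algebra.Primes"
begin

text \<open>A letter \<open>(x, True)\<close> stands for the generator \<open>x\<close>, and \<open>(x, False)\<close> for its formal inverse.\<close>

type_synonym 'g word = "('g \<times> bool) list"

inductive word_cong :: "('g word \<times> 'g word) set \<Rightarrow> 'g word \<Rightarrow> 'g word \<Rightarrow> bool"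
  for rels :: "('g word \<times> 'g word) set"
where
  relation: "(v, w) \<in> rels \<Longrightarrow> word_cong rels v w"
| cancel: "word_cong rels [(x, b), (x, \<not> b)] []"
| refl: "word_cong rels w w"
| sym: "word_cong rels v w \<Longrightarrow> word_cong rels w v"
| trans: "word_cong rels u v \<Longrightarrow> word_cong rels v w \<Longrightarrow> word_cong rels u w"
| append: "word_cong rels v v' \<Longrightarrow> word_cong rels w w' \<Longrightarrow> word_cong rels (v @ w) (v' @ w')"

definition word_class :: "('g word \<times> 'g word) set \<Rightarrow> 'g word \<Rightarrow> 'g word set" where
  "word_class rels w = {v. word_cong rels w v}"

text \<open>The group generated by all elements of the type \<open>'g\<close> subject to the relations
  \<open>v = w\<close> for \<open>(v, w) \<in> rels\<close>.\<close>

definition presented_group :: "('g word \<times> 'g word) set \<Rightarrow> 'g word set monoid" where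
  "presented_group rels =
    \<lparr>carrier = range (word_class rels),
     monoid.mult = (\<lambda>A B. \<Union>v\<in>A. \<Union>w\<in>B. word_class rels (v @ w)),
     monoid.one = word_class rels []\<rparr>"

definition presented_gen :: "('g word \<times> 'g word) set \<Rightarrow> 'g \<Rightarrow> 'g word set" where
  "presented_gen rels x = word_class rels [(x, True)]"

lemma word_class_eq_iff: "word_class rels v = word_class rels w \<longleftrightarrow> word_cong rels v w"
proof
  assume "word_class rels v = word_class rels w"
  then have "w \<in> word_class rels v"
    by (simp add: word_class_def word_cong.refl)
  then show "word_cong rels v w"
    by (simp add: word_class_def)
next
  assume "word_cong rels v w"
  then have "word_cong rels v x \<longleftrightarrow> word_cong rels w x" for x
    by (metis word_cong.sym word_cong.trans)
  then show "word_class rels v = word_class rels w"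
    by (simp add: word_class_def)
qed

lemma presented_group_mult:
  "word_class rels v \<otimes>\<^bsub>presented_group rels\<^esub> word_class rels w = word_class rels (v @ w)"
proof -
  have "word_class rels (v' @ w') = word_class rels (v @ w)"
    if "v' \<in> word_class rels v" "w' \<in> word_class rels w" for v' w'
    using that unfolding word_class_eq_iff
    by (simp add: word_class_def word_cong.sym word_cong.append)
  moreover have "v \<in> word_class rels v" "w \<in> word_class rels w"
    by (simp_all add: word_class_def word_cong.refl)
  ultimately have "(\<Union>v'\<in>word_class rels v. \<Union>w'\<in>word_class rels w. word_class rels (v' @ w'))
      = word_class rels (v @ w)"
    by blast
  then show ?thesis
    by (simp add: presented_group_def)
qed

lemma word_cong_inverse:
  "word_cong rels (rev (map (\<lambda>(x, b). (x, \<not> b)) w) @ w) []"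
proof (induction w)
  case Nil
  then show ?case by (simp add: word_cong.refl)
next
  case (Cons a w)
  obtain x b where a: "a = (x, b)" by (cases a)
  let ?i = "rev (map (\<lambda>(x, b). (x, \<not> b)) w)"
  have "word_cong rels [(x, \<not> b), (x, b)] []"
    using word_cong.cancel[of rels x "\<not> b"] by simp
  then have "word_cong rels (?i @ ([(x, \<not> b), (x, b)] @ w)) (?i @ ([] @ w))"
    by (intro word_cong.append word_cong.refl)
  then have "word_cong rels (?i @ ([(x, \<not> b), (x, b)] @ w)) (?i @ w)"
    by simp
  from word_cong.trans[OF this Cons.IH] show ?case
    by (simp add: a)
qed

lemma group_presented_group: "group (presented_group rels)"
proof (rule groupI)
  fix A B C
  assume "A \<in> carrier (presented_group rels)" "B \<in> carrier (presented_group rels)"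
    "C \<in> carrier (presented_group rels)"
  then obtain u v w where "A = word_class rels u" "B = word_class rels v" "C = word_class rels w"
    by (auto simp: presented_group_def)
  then show "A \<otimes>\<^bsub>presented_group rels\<^esub> B \<otimes>\<^bsub>presented_group rels\<^esub> C =
      A \<otimes>\<^bsub>presented_group rels\<^esub> (B \<otimes>\<^bsub>presented_group rels\<^esub> C)"
    by (simp add: presented_group_mult)
next
  fix A B
  assume "A \<in> carrier (presented_group rels)" "B \<in> carrier (presented_group rels)"
  then obtain u v where "A = word_class rels u" "B = word_class rels v"
    by (auto simp: presented_group_def)
  then show "A \<otimes>\<^bsub>presented_group rels\<^esub> B \<in> carrier (presented_group rels)"
    by (simp add: presented_group_mult) (simp add: presented_group_def)
next
  show "\<one>\<^bsub>presented_group rels\<^esub> \<in> carrier (presented_group rels)"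
    by (simp add: presented_group_def)
next
  fix A
  assume "A \<in> carrier (presented_group rels)"
  then obtain w where A: "A = word_class rels w"
    by (auto simp: presented_group_def)
  have one: "\<one>\<^bsub>presented_group rels\<^esub> = word_class rels []"
    by (simp add: presented_group_def)
  show "\<one>\<^bsub>presented_group rels\<^esub> \<otimes>\<^bsub>presented_group rels\<^esub> A = A"
    by (simp add: A one presented_group_mult)
  let ?i = "rev (map (\<lambda>(x, b). (x, \<not> b)) w)"
  have "word_class rels ?i \<otimes>\<^bsub>presented_group rels\<^esub> A = \<one>\<^bsub>presented_group rels\<^esub>"
    by (simp add: A one presented_group_mult word_class_eq_iff word_cong_inverse)
  moreover have "word_class rels ?i \<in> carrier (presented_group rels)"
    by (simp add: presented_group_def)
  ultimately show "\<exists>B\<in>carrier (presented_group rels).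
      B \<otimes>\<^bsub>presented_group rels\<^esub> A = \<one>\<^bsub>presented_group rels\<^esub>"
    by blast
qed

datatype sd_gen = Gen_s | Gen_r

definition sd_rels :: "nat \<Rightarrow> nat \<Rightarrow> (sd_gen word \<times> sd_gen word) set" where
  "sd_rels k p =
    {(replicate (2 ^ k * p) (Gen_r, True), []),
     (replicate 2 (Gen_s, True), []),
     ([(Gen_s, True), (Gen_r, True), (Gen_s, False)],
      replicate (2 ^ (k - 1) * p - 1) (Gen_r, True))}"

abbreviation sd_group :: "nat \<Rightarrow> nat \<Rightarrow> sd_gen word set monoid" where
  "sd_group k p \<equiv> presented_group (sd_rels k p)"

abbreviation sd_s :: "nat \<Rightarrow> nat \<Rightarrow> sd_gen word set" where
  "sd_s k p \<equiv> presented_gen (sd_rels k p) Gen_s"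

abbreviation sd_r :: "nat \<Rightarrow> nat \<Rightarrow> sd_gen word set" where
  "sd_r k p \<equiv> presented_gen (sd_rels k p) Gen_r"

record 'v graph =
  verts :: "'v set"
  edges :: "'v set set"

definition complete_graph :: "'v set \<Rightarrow> 'v graph" where
  "complete_graph V = \<lparr>verts = V, edges = {{x, y} | x y. x \<in> V \<and> y \<in> V \<and> x \<noteq> y}\<rparr>"

abbreviation K :: "nat \<Rightarrow> nat graph" where
  "K n \<equiv> complete_graph {..<n}"

text \<open>Vertices with the same name are identified.\<close>

definition graph_union :: "'v graph \<Rightarrow> 'v graph \<Rightarrow> 'v graph" where
  "graph_union \<Gamma> \<Delta> = \<lparr>verts = verts \<Gamma> \<union> verts \<Delta>, edges = edges \<Gamma> \<union> edges \<Delta>\<rparr>"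

definition graph_Union :: "'v graph set \<Rightarrow> 'v graph" where
  "graph_Union F = \<lparr>verts = \<Union> (verts ` F), edges = \<Union> (edges ` F)\<rparr>"

text \<open>The join is meant for graphs with disjoint vertex sets.\<close>

definition graph_join :: "'v graph \<Rightarrow> 'v graph \<Rightarrow> 'v graph" where
  "graph_join \<Gamma> \<Delta> =
    \<lparr>verts = verts \<Gamma> \<union> verts \<Delta>,
     edges = edges \<Gamma> \<union> edges \<Delta> \<union> {{x, y} | x y. x \<in> verts \<Gamma> \<and> y \<in> verts \<Delta>}\<rparr>"

definition graph_rename :: "('v \<Rightarrow> 'w) \<Rightarrow> 'v graph \<Rightarrow> 'w graph" where
  "graph_rename f \<Gamma> = \<lparr>verts = f ` verts \<Gamma>, edges = (\<lambda>e. f ` e) ` edges \<Gamma>\<rparr>"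

text \<open>The join of two abstract graphs, whose vertex sets are first made disjoint.\<close>

definition graph_sum_join :: "'v graph \<Rightarrow> 'w graph \<Rightarrow> ('v + 'w) graph" where
  "graph_sum_join \<Gamma> \<Delta> = graph_join (graph_rename Inl \<Gamma>) (graph_rename Inr \<Delta>)"

definition graph_iso :: "'v graph \<Rightarrow> 'w graph \<Rightarrow> bool" where
  "graph_iso \<Gamma> \<Delta> \<longleftrightarrow>
    (\<exists>f. bij_betw f (verts \<Gamma>) (verts \<Delta>) \<and>
      (\<forall>x\<in>verts \<Gamma>. \<forall>y\<in>verts \<Gamma>. {x, y} \<in> edges \<Gamma> \<longleftrightarrow> {f x, f y} \<in> edges \<Delta>))"

text \<open>\<open>F\<close> consists of \<open>n\<close> different copies of \<open>\<Gamma>\<close>; the copies may share vertices.\<close>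

definition are_copies :: "nat \<Rightarrow> 'w graph \<Rightarrow> 'v graph set \<Rightarrow> bool" where
  "are_copies n \<Gamma> F \<longleftrightarrow> finite F \<and> card F = n \<and> (\<forall>\<Delta>\<in>F. graph_iso \<Delta> \<Gamma>)"

definition power_graph :: "('a, 'b) monoid_scheme \<Rightarrow> 'a graph" where
  "power_graph G =
    \<lparr>verts = carrier G,
     edges = {{x, y} | x y. x \<in> carrier G \<and> y \<in> carrier G \<and> x \<noteq> y \<and>
       ((\<exists>n::int. x = y [^]\<^bsub>G\<^esub> n) \<or> (\<exists>n::int. y = x [^]\<^bsub>G\<^esub> n))}\<rparr>"

abbreviation cyclic_subgroup :: "('a, 'b) monoid_scheme \<Rightarrow> 'a \<Rightarrow> 'a set" where
  "cyclic_subgroup G x \<equiv> generate G {x}"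

definition cyclic_generators :: "('a, 'b) monoid_scheme \<Rightarrow> 'a set \<Rightarrow> 'a set" where
  "cyclic_generators G C = {x \<in> carrier G. cyclic_subgroup G x = C}"

end

theory Submission
  imports Defs
begin

text \<open>Put \<open>n = 2\<^sup>k p\<close>, \<open>h = n/2\<close> and \<open>c = h - 1\<close>; since \<open>h\<close> is even, \<open>c\<^sup>2 \<equiv> 1 (mod n)\<close>. Reading a word
  from the right, the parity of the number of letters \<open>s\<close> and the sum of the exponents of \<open>r\<close>,
  each multiplied by \<open>c\<close> if an odd number of letters \<open>s\<close> stands to its right, taken modulo \<open>n\<close>, are invariants of
  the presented group. Hence it consists of the \<open>2n\<close> distinct elements \<open>r\<^sup>i\<close>, \<open>s r\<^sup>i\<close>.
  As \<open>(s r\<^sup>i)\<^sup>2 = r\<^sup>h\<^sup>i\<close>, each element outside \<open>\<langle>r\<rangle>\<close> has fourth power \<open>e\<close> and generates a cyclic group in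
  which any two elements are comparable. So the power graph is the union of \<open>P(\<langle>r\<rangle>)\<close> and of the
  complete graphs on \<open>\<langle>s r\<^sup>i\<rangle>\<close>, which are copies of \<open>K\<^sub>2\<close> for even \<open>i\<close> and of \<open>K\<^sub>4 = P(\<langle>u\<rangle>) + K\<^sub>2\<close> for odd \<open>i\<close>.\<close>

section \<open>Complete graphs and power graphs\<close>

lemma verts_complete_graph [simp]: "verts (complete_graph V) = V"
  by (simp add: complete_graph_def)

lemma edges_complete_graph:
  "edges (complete_graph V) = {{x, y} | x y. x \<in> V \<and> y \<in> V \<and> x \<noteq> y}"
  by (simp add: complete_graph_def)

text \<open>Families of complete graphs can therefore be counted through their vertex sets.\<close>

lemma inj_complete_graph: "inj_on complete_graph A"
  by (metis inj_onI verts_complete_graph)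

lemma complete_graph_rename:
  assumes "inj_on f V"
  shows "graph_rename f (complete_graph V) = complete_graph (f ` V)"
  unfolding graph_rename_def complete_graph_def
  using assms by (auto simp: inj_on_def image_iff) (metis image_empty image_insert)

text \<open>Without disjointness, a common vertex \<open>x\<close> would put the singleton
  \<open>{x}\<close> among the edges of the join.\<close>

lemma graph_join_complete_graph:
  assumes "V \<inter> W = {}"
  shows "graph_join (complete_graph V) (complete_graph W) = complete_graph (V \<union> W)"
  unfolding graph_join_def complete_graph_def
  using assms by (auto simp: doubleton_eq_iff) blast+

lemma graph_sum_join_complete_graph:
  "graph_sum_join (complete_graph V) (complete_graph W) = complete_graph (V <+> W)"
  unfolding graph_sum_join_def Plus_def
  by (subst (1 2) complete_graph_rename) (auto intro!: graph_join_complete_graph)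

lemma graph_iso_complete_graph:
  assumes "finite V" "finite W" "card V = card W"
  shows "graph_iso (complete_graph V) (complete_graph W)"
proof -
  obtain f where f: "bij_betw f V W"
    using finite_same_card_bij assms by blast
  have "{x, y} \<in> edges (complete_graph V) \<longleftrightarrow> {f x, f y} \<in> edges (complete_graph W)"
    if "x \<in> V" "y \<in> V" for x y
  proof -
    have "f x \<in> W" "f y \<in> W" "f x = f y \<longleftrightarrow> x = y"
      using f that by (auto simp: bij_betw_def inj_on_def)
    then show ?thesis
      using that unfolding edges_complete_graph by (auto simp: doubleton_eq_iff)
  qed
  then show ?thesis
    unfolding graph_iso_def using f by auto
qed

section \<open>Adjacency in power graphs\<close>

lemma verts_power_graph [simp]: "verts (power_graph G) = carrier G"
  by (simp add: power_graph_def)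

lemma power_graph_edge_iff:
  "{x, y} \<in> edges (power_graph G) \<longleftrightarrow> x \<in> carrier G \<and> y \<in> carrier G \<and> x \<noteq> y \<and>
     ((\<exists>n::int. x = y [^]\<^bsub>G\<^esub> n) \<or> (\<exists>n::int. y = x [^]\<^bsub>G\<^esub> n))"
  by (auto simp: power_graph_def doubleton_eq_iff)

lemma power_graph_edgeE:
  assumes "e \<in> edges (power_graph G)"
  obtains x y where "e = {x, y}"
  using assms by (auto simp: power_graph_def)

lemma graph_iso_power_graph:
  assumes "group G" "group H" "f \<in> Group.iso G H"
  shows "graph_iso (power_graph G) (power_graph H)"
proof -
  have hom: "f \<in> hom G H" and bij: "bij_betw f (carrier G) (carrier H)"
    using assms(3) by (auto simp: Group.iso_def)
  have inj: "f a = f b \<longleftrightarrow> a = b" if "a \<in> carrier G" "b \<in> carrier G" for a b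
    using bij that by (auto simp: bij_betw_def inj_on_def)
  have pow: "f x = f y [^]\<^bsub>H\<^esub> n \<longleftrightarrow> x = y [^]\<^bsub>G\<^esub> n"
    if "x \<in> carrier G" "y \<in> carrier G" for x y and n :: int
    using that hom_int_pow[OF hom _ assms(1,2)] inj group.int_pow_closed[OF assms(1)] by metis
  show ?thesis
    unfolding graph_iso_def
    by (rule exI[of _ f])
      (use bij in \<open>auto simp: power_graph_edge_iff pow inj bij_betw_apply\<close>)
qed

context group
begin

lemma power_graph_edge_iff_generate:
  "{x, y} \<in> edges (power_graph G) \<longleftrightarrow> x \<in> carrier G \<and> y \<in> carrier G \<and> x \<noteq> y \<and>
     (x \<in> generate G {y} \<or> y \<in> generate G {x})"
  by (auto simp: power_graph_edge_iff generate_pow)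

lemma power_graph_edge_iff_subgroup:
  assumes "subgroup H G"
  shows "{x, y} \<in> edges (power_graph (G\<lparr>carrier := H\<rparr>)) \<longleftrightarrow>
    {x, y} \<in> edges (power_graph G) \<and> x \<in> H \<and> y \<in> H"
  using subgroup.subset[OF assms]
  by (auto simp: power_graph_edge_iff int_pow_consistent[OF assms])

text \<open>If \<open>x\<close> is a power of \<open>y\<close>, both lie in
  \<open>generate G {y}\<close>: inside \<open>H\<close> when \<open>y\<close> is in
  \<open>H\<close>, and otherwise inside a cyclic group generated from outside \<open>H\<close>.
  Comparability makes each of the latter groups a clique.\<close>

lemma edges_power_graph_decomp:
  assumes H: "subgroup H G"
    and comparable: "\<And>x y z. \<lbrakk>x \<in> carrier G - H; y \<in> generate G {x}; z \<in> generate G {x}\<rbrakk>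
      \<Longrightarrow> y \<in> generate G {z} \<or> z \<in> generate G {y}"
  shows "edges (power_graph G) = edges (power_graph (G\<lparr>carrier := H\<rparr>)) \<union>
    (\<Union>x\<in>carrier G - H. edges (complete_graph (generate G {x})))" (is "?L = ?P \<union> ?U")
proof (intro subset_antisym subsetI)
  fix e assume "e \<in> ?L"
  moreover obtain x y where e: "e = {x, y}"
    using \<open>e \<in> ?L\<close> by (rule power_graph_edgeE)
  ultimately have xy: "{x, y} \<in> ?L" by simp
  have self: "z \<in> generate G {z}" for z
    by (simp add: generate.incl)
  have cyc: "generate G {z} \<subseteq> H" if "z \<in> H" for z
    using generate_subgroup_incl[OF _ H] that by simp
  from xy show "e \<in> ?P \<union> ?U"
    unfolding e Un_iff power_graph_edge_iff_subgroup[OF H]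
    unfolding power_graph_edge_iff_generate edges_complete_graph
    using self cyc by blast
next
  fix e assume "e \<in> ?P \<union> ?U"
  then show "e \<in> ?L"
  proof
    assume "e \<in> ?P"
    then show ?thesis
      by (metis power_graph_edgeE power_graph_edge_iff_subgroup[OF H])
  next
    assume "e \<in> ?U"
    then obtain x y z where *: "x \<in> carrier G - H" "y \<in> generate G {x}" "z \<in> generate G {x}"
        "y \<noteq> z" "e = {y, z}"
      unfolding edges_complete_graph by blast
    moreover have "generate G {x} \<subseteq> carrier G"
      using * generate_incl by simp
    ultimately show ?thesis
      using comparable[OF *(1-3)] by (auto simp: power_graph_edge_iff_generate)
  qed
qed

section \<open>Cyclic groups generated by an element with trivial fourth power\<close>

lemma generate_pow4:
  assumes x: "x \<in> carrier G" and "x [^] (4::int) = \<one>"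
  shows "generate G {x} = {\<one>, x, x [^] (2::int), x [^] (3::int)}"
proof -
  have "x [^] m = x [^] (m mod 4)" for m :: int
  proof -
    have "x [^] m = x [^] (4 * (m div 4) + m mod 4)" by simp
    also have "\<dots> = x [^] (4 * (m div 4)) \<otimes> x [^] (m mod 4)"
      by (simp only: int_pow_mult[OF x])
    also have "x [^] (4 * (m div 4)) = \<one>"
      using int_pow_pow[OF x, of 4 "m div 4"] assms by simp
    finally show ?thesis using x by simp
  qed
  moreover have "m mod 4 \<in> {0, 1, 2, 3}" for m :: int
    by simp presburger
  ultimately have "x [^] m \<in> {x [^] (0::int), x [^] (1::int), x [^] (2::int), x [^] (3::int)}"
    for m :: int
    by (metis (no_types, opaque_lifting) insert_iff empty_iff)
  then show ?thesis
    unfolding generate_pow[OF x] using x int_pow_0[of G x] int_pow_1[OF x]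
    by (auto; metis)
qed

text \<open>Both x and x^3 generate the whole cyclic group, so only e and x^2 remain to be compared,
  and e is a power of everything.\<close>

lemma generate_pow4_comparable:
  assumes x: "x \<in> carrier G" and 4: "x [^] (4::int) = \<one>"
    and y: "y \<in> generate G {x}" and z: "z \<in> generate G {x}"
  shows "y \<in> generate G {z} \<or> z \<in> generate G {y}"
proof -
  \<comment> \<open>This is x^9 = x, which exhibits x as a power of x^3.\<close>
  have "(x [^] (3::int)) [^] (3::int) = x [^] (4::int) \<otimes> x [^] (4::int) \<otimes> x"
    using int_pow_pow[OF x, of 3 3] int_pow_mult[OF x, of 8 1] int_pow_mult[OF x, of 4 4] x
    by simp
  then have "x = (x [^] (3::int)) [^] (3::int)"
    using 4 x by simp
  then have "x \<in> generate G {x [^] (3::int)}"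
    using x by (auto simp: generate_pow)
  then have "generate G {x} \<subseteq> generate G {x [^] (3::int)}"
    using x by (intro generate_subgroup_incl generate_is_subgroup) auto
  moreover have "x [^] (2::int) \<in> generate G {x}"
    by (simp add: generate_pow4[OF x 4])
  moreover have "x [^] (3::int) \<in> generate G {x}"
    by (simp add: generate_pow4[OF x 4])
  moreover have "y \<in> {\<one>, x, x [^] (2::int), x [^] (3::int)}"
    "z \<in> {\<one>, x, x [^] (2::int), x [^] (3::int)}"
    using y z by (simp_all only: generate_pow4[OF x 4])
  ultimately show ?thesis
    using generate.one[of G] generate.incl[of _ _ G] by auto
qed

end

section \<open>Semidihedral groups of order \<open>8q\<close>\<close>

text \<open>The consequences of the presentation on which the graph computation rests. With q =
  2^(k-2) p, the element r has order 4q and u = r^(2q); \<open>r_s\<close> is the conjugation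
  relation multiplied by s on the left.\<close>

locale semidihedral = group G for G (structure) +
  fixes q :: nat and s r
  assumes q_pos: "0 < q"
    and s_closed [simp]: "s \<in> carrier G"
    and r_closed [simp]: "r \<in> carrier G"
    and s_square: "s \<otimes> s = \<one>"
    and r_s: "r \<otimes> s = s \<otimes> r [^] (2 * int q - 1)"
    and r_pow_eq_iff: "\<And>i j :: int. r [^] i = r [^] j \<longleftrightarrow> 4 * int q dvd i - j"
    and s_neq_r_pow: "\<And>i :: int. s \<noteq> r [^] i"
    and carrier_cases: "\<And>x. x \<in> carrier G \<Longrightarrow> \<exists>i :: int. x = r [^] i \<or> x = s \<otimes> r [^] i"
begin

section \<open>Normal forms and their multiplication table\<close>

definition R where "R i = r [^] (i :: int)"
definition S where "S i = s \<otimes> r [^] (i :: int)"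

lemma R_closed [simp]: "R i \<in> carrier G" and S_closed [simp]: "S i \<in> carrier G"
  by (simp_all add: R_def S_def)

lemma R_R: "R i \<otimes> R j = R (i + j)"
  by (simp add: R_def int_pow_mult)

lemma R_0: "R 0 = \<one>"
  by (simp add: R_def)

lemma R_eq_iff: "R i = R j \<longleftrightarrow> 4 * int q dvd i - j"
  by (simp add: R_def r_pow_eq_iff)

lemma S_eq_iff: "S i = S j \<longleftrightarrow> 4 * int q dvd i - j"
  by (simp add: S_def r_pow_eq_iff)

lemma S_neq_R: "S i \<noteq> R j"
proof
  assume "S i = R j"
  then have "s = r [^] (j - i)"
    by (simp add: R_def S_def int_pow_diff inv_solve_right)
  then show False
    using s_neq_r_pow by blast
qed

text \<open>Each factor r that s passes turns into r^(2q-1). The induction runs in both directions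
  because exponents are integers.\<close>

lemma R_s: "R i \<otimes> s = s \<otimes> R (i * (2 * int q - 1))"
proof (induction i rule: int_induct[where k = 0])
  case base
  then show ?case by (simp add: R_0)
next
  case (step1 i)
  have "R (i + 1) \<otimes> s = R i \<otimes> (r \<otimes> s)"
    by (simp add: R_def int_pow_mult m_assoc)
  also have "\<dots> = (R i \<otimes> s) \<otimes> R (2 * int q - 1)"
    unfolding r_s by (simp add: R_def m_assoc)
  also have "\<dots> = s \<otimes> R (i * (2 * int q - 1) + (2 * int q - 1))"
    by (simp add: step1 m_assoc R_R)
  finally show ?case by (simp add: algebra_simps)
next
  case (step2 i)
  \<comment> \<open>The relation \<open>r_s\<close> solved for \<open>s\<close>: the new factor
    \<open>R 1\<close> turns \<open>R (i - 1)\<close> into \<open>R i\<close>, where the induction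
    hypothesis applies.\<close>
  have "s = s \<otimes> R (2 * int q - 1) \<otimes> R (1 - 2 * int q)"
    by (simp add: m_assoc R_R R_0)
  also have "s \<otimes> R (2 * int q - 1) = R 1 \<otimes> s"
    by (simp add: R_def r_s)
  finally have "R (i - 1) \<otimes> s = R (i - 1) \<otimes> (R 1 \<otimes> s \<otimes> R (1 - 2 * int q))"
    by simp
  also have "\<dots> = (R (i - 1) \<otimes> R 1) \<otimes> s \<otimes> R (1 - 2 * int q)"
    by (simp add: m_assoc)
  also have "\<dots> = R i \<otimes> s \<otimes> R (1 - 2 * int q)"
    by (simp add: R_R)
  also have "\<dots> = s \<otimes> R (i * (2 * int q - 1) + (1 - 2 * int q))"
    by (simp add: step2 m_assoc R_R)
  finally show ?case by (simp add: algebra_simps)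
qed

lemma S_R: "S i \<otimes> R j = S (i + j)"
  by (simp add: S_def R_def int_pow_mult m_assoc)

lemma S_S: "S i \<otimes> S j = R (i * (2 * int q - 1) + j)"
proof -
  have "S i \<otimes> S j = s \<otimes> (R i \<otimes> s) \<otimes> R j"
    by (simp add: S_def R_def m_assoc)
  also have "\<dots> = s \<otimes> s \<otimes> (R (i * (2 * int q - 1)) \<otimes> R j)"
    unfolding R_s by (simp add: m_assoc)
  finally show ?thesis
    by (simp add: s_square R_R)
qed

text \<open>The exponent i(2q-1) + i collapses to 2qi, so modulo 4q only the parity of i
  matters.\<close>

lemma S_pow_2: "S i [^] (2::int) = R (2 * int q * i)"
proof -
  have "S i [^] (2::int) = S i \<otimes> S i"
    using int_pow_mult[of "S i" 1 1] by simp
  then show ?thesis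
    by (simp add: S_S algebra_simps)
qed

lemma S_pow_3: "S i [^] (3::int) = S (i + 2 * int q * i)"
  using int_pow_mult[of "S i" 1 2] by (simp add: S_pow_2 S_R)

lemma S_pow_4: "S i [^] (4::int) = \<one>"
  using int_pow_mult[of "S i" 2 2] R_eq_iff[of "4 * int q * i" 0]
  by (simp add: S_pow_2 R_R R_0 algebra_simps)

lemma generate_r: "generate G {r} = range R"
  by (auto simp: generate_pow R_def)

lemma carrier_eq: "carrier G = range R \<union> range S"
proof -
  have "R i \<in> carrier G" "S i \<in> carrier G" for i
    by simp_all
  moreover have "x \<in> range R \<union> range S" if "x \<in> carrier G" for x
    using carrier_cases[OF that] unfolding R_def S_def by blast
  ultimately show ?thesis by blast
qed

section \<open>Cyclic subgroups outside \<open>generate G {r}\<close>\<close>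

lemma carrier_minus: "carrier G - generate G {r} = range S"
  using S_neq_R by (auto simp: carrier_eq generate_r)

text \<open>Here 2qi is a multiple of 4q, so \<open>S i\<close> is an involution.\<close>

lemma generate_S_even:
  assumes "even i"
  shows "generate G {S i} = {\<one>, S i}"
proof -
  have "4 * int q dvd 2 * int q * i"
    using mult_dvd_mono[of 2 i "2 * int q" "2 * int q"] assms by (simp add: mult.commute)
  then have "R (2 * int q * i) = \<one>" "S (i + 2 * int q * i) = S i"
    using R_eq_iff[of _ 0] by (simp_all add: R_0 S_eq_iff)
  then show ?thesis
    by (simp add: generate_pow4 S_pow_4 S_pow_2 S_pow_3 insert_commute)
qed

lemma dvd_odd: "odd i \<Longrightarrow> 4 * int q dvd 2 * int q * i - 2 * int q"
  using mult_dvd_mono[of 2 "i - 1" "2 * int q" "2 * int q"] by (simp add: algebra_simps)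

text \<open>Now 2qi is 2q modulo 4q: the square of \<open>S i\<close> is u, and its cube is
  \<open>S i\<close> with the index shifted by 2q.\<close>

lemma generate_S_odd:
  assumes "odd i"
  shows "generate G {S i} = {\<one>, R (2 * int q), S i, S (i + 2 * int q)}"
proof -
  have "R (2 * int q * i) = R (2 * int q)" "S (i + 2 * int q * i) = S (i + 2 * int q)"
    using dvd_odd[OF assms] by (simp_all add: R_eq_iff S_eq_iff)
  then show ?thesis
    by (simp add: generate_pow4 S_pow_4 S_pow_2 S_pow_3 insert_commute)
qed

text \<open>Positivity of \<open>q\<close> enters here; it separates u from the identity.\<close>

lemma not_dvd_half: "\<not> 4 * int q dvd 2 * int q"
  using q_pos zdvd_imp_le[of "4 * int q" "2 * int q"] by auto

lemma u_neq_one: "R (2 * int q) \<noteq> \<one>"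
  using not_dvd_half R_eq_iff[of _ 0] by (simp add: R_0)

lemma u_square: "R (2 * int q) \<otimes> R (2 * int q) = \<one>"
  using R_eq_iff[of "4 * int q" 0] by (simp add: R_R R_0)

lemma generate_u: "generate G {R (2 * int q)} = {\<one>, R (2 * int q)}" (is "generate G {?u} = _")
proof -
  have 2: "?u [^] (2::int) = \<one>"
    using u_square int_pow_mult[of ?u 1 1] by simp
  then have "?u [^] (3::int) = ?u" "?u [^] (4::int) = \<one>"
    using int_pow_mult[of ?u 2 1] int_pow_mult[of ?u 2 2] by simp_all
  then show ?thesis
    using 2 by (simp add: generate_pow4 insert_commute)
qed

text \<open>A generator is one of the four elements of the group. The identity and u generate
  subgroups that miss \<open>S i\<close>, while a second shift of the index by 2q leads back to
  \<open>S i\<close>.\<close>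

lemma cyclic_generators_S_odd:
  assumes "odd i"
  shows "cyclic_generators G (generate G {S i}) = {S i, S (i + 2 * int q)}"
proof -
  have "S (i + 2 * int q + 2 * int q) = S i"
    by (simp add: S_eq_iff)
  then have "generate G {S (i + 2 * int q)} = generate G {S i}"
    using assms by (simp add: generate_S_odd insert_commute)
  moreover have "S i \<noteq> \<one>" "S i \<noteq> R (2 * int q)"
    using S_neq_R R_0 by metis+
  then have "generate G {\<one>} \<noteq> generate G {S i}"
    "generate G {R (2 * int q)} \<noteq> generate G {S i}"
    unfolding generate_S_odd[OF assms] generate_u generate_one by auto
  moreover have "x \<in> {\<one>, R (2 * int q), S i, S (i + 2 * int q)}"
    if "generate G {x} = generate G {S i}" for x
    using that generate.incl[of x "{x}" G] generate_S_odd[OF assms] by simp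
  ultimately have "generate G {x} = generate G {S i} \<longleftrightarrow> x \<in> {S i, S (i + 2 * int q)}" for x
    by blast
  then show ?thesis
    unfolding cyclic_generators_def by auto
qed

section \<open>The pieces of the power graph\<close>

lemma edges_power_graph_semidihedral:
  "edges (power_graph G) = edges (power_graph (G\<lparr>carrier := generate G {r}\<rparr>)) \<union>
    (\<Union>i. edges (complete_graph (generate G {S i})))"
proof -
  have "y \<in> generate G {z} \<or> z \<in> generate G {y}"
    if "x \<in> carrier G - generate G {r}" "y \<in> generate G {x}" "z \<in> generate G {x}" for x y z
    using that generate_pow4_comparable[of x y z] S_pow_4 unfolding carrier_minus by auto
  then have "edges (power_graph G) = edges (power_graph (G\<lparr>carrier := generate G {r}\<rparr>)) \<union>
      (\<Union>x\<in>range S. edges (complete_graph (generate G {x})))"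
    unfolding carrier_minus[symmetric]
    by (intro edges_power_graph_decomp generate_is_subgroup) simp_all
  then show ?thesis
    by simp
qed

lemma graph_iso_power_graph_r:
  "graph_iso (power_graph (G\<lparr>carrier := generate G {r}\<rparr>)) (power_graph (integer_mod_group (4 * q)))"
proof -
  let ?H = "G\<lparr>carrier := generate G {r}\<rparr>"
  have sub: "subgroup (generate G {r}) G"
    by (simp add: generate_is_subgroup)
  have n: "4 * int q > 0"
    using q_pos by simp
  \<comment> \<open>The exponent is chosen arbitrarily; its residue modulo 4q does not depend on the
    choice.\<close>
  define f where "f x = (SOME i. R i = x) mod (4 * int q)" for x
  have f: "f (R i) = i mod (4 * int q)" for i
  proof -
    have "R (SOME j. R j = R i) = R i"
      by (rule someI) (rule HOL.refl)
    then show ?thesis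
      unfolding f_def R_eq_iff by (simp add: mod_eq_dvd_iff)
  qed
  have "f \<in> hom ?H (integer_mod_group (4 * q))"
    using n by (auto simp: hom_def generate_r carrier_integer_mod_group f R_R mod_add_eq)
  moreover have "bij_betw f (range R) {0..<4 * int q}"
    unfolding bij_betw_def
  proof
    show "inj_on f (range R)"
      by (auto simp: inj_on_def f R_eq_iff mod_eq_dvd_iff)
    have "i \<in> f ` range R" if "0 \<le> i" "i < 4 * int q" for i
      using that f[of i] by (metis mod_pos_pos_trivial rangeI image_eqI)
    then show "f ` range R = {0..<4 * int q}"
      using n by (auto simp: f)
  qed
  ultimately have "f \<in> Group.iso ?H (integer_mod_group (4 * q))"
    using q_pos by (simp add: Group.iso_def generate_r carrier_integer_mod_group)
  then show ?thesis
    using subgroup_imp_group[OF sub] by (intro graph_iso_power_graph) auto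
qed

lemma power_graph_u:
  "power_graph (G\<lparr>carrier := generate G {R (2 * int q)}\<rparr>) = complete_graph {\<one>, R (2 * int q)}"
  (is "?P = complete_graph {\<one>, ?u}")
proof -
  have sub: "subgroup {\<one>, ?u} G"
    using generate_is_subgroup[of "{?u}"] by (simp add: generate_u)
  have "e \<in> edges ?P \<longleftrightarrow> e = {\<one>, ?u}" for e
  proof
    assume "e \<in> edges ?P"
    moreover then obtain x y where "e = {x, y}"
      by (rule power_graph_edgeE)
    ultimately show "e = {\<one>, ?u}"
      unfolding generate_u
      by (auto simp: power_graph_edge_iff_subgroup[OF sub] power_graph_edge_iff_generate)
  next
    assume e: "e = {\<one>, ?u}"
    show "e \<in> edges ?P"
      unfolding e generate_u power_graph_edge_iff_subgroup[OF sub]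
      unfolding power_graph_edge_iff_generate generate_u using u_neq_one by auto
  qed
  moreover have "edges (complete_graph {\<one>, ?u}) = {{\<one>, ?u}}"
    using u_neq_one unfolding edges_complete_graph by (auto simp: insert_commute)
  ultimately have "edges ?P = edges (complete_graph {\<one>, ?u})"
    by auto
  then show ?thesis
    by (simp add: complete_graph_def power_graph_def generate_u)
qed

section \<open>Enumeration of the involutions and of the cyclic subgroups of order 4\<close>

lemma nat_pow_r: "r [^] (m :: nat) = R (int m)"
  by (simp add: R_def int_pow_int)

lemma even_indices: "(\<lambda>t. S (2 * int t)) ` {1..2 * q} = S ` {i. even i}"
proof (intro subset_antisym subsetI)
  fix x assume "x \<in> S ` {i. even i}"
  then obtain j where x: "x = S (2 * j)" by (auto elim!: evenE)
  \<comment> \<open>Subtracting 1 before the reduction and adding it afterwards puts the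
    representative of \<open>j\<close> modulo 2q into 1..2q instead of 0..2q-1.\<close>
  define t where "t = nat ((j - 1) mod (2 * int q)) + 1"
  have lt: "(j - 1) mod (2 * int q) < 2 * int q" and ge: "0 \<le> (j - 1) mod (2 * int q)"
    using q_pos by simp_all
  have "2 * int q dvd (j - 1) - (j - 1) mod (2 * int q)"
    by (rule dvd_minus_mod)
  then have "2 * (2 * int q) dvd 2 * (j - int t)"
    unfolding t_def using ge by (intro mult_dvd_mono) (simp_all add: algebra_simps)
  then have "x = S (2 * int t)"
    unfolding x S_eq_iff by (simp add: algebra_simps)
  moreover have "t \<in> {1..2 * q}"
    unfolding t_def using lt ge by auto
  ultimately show "x \<in> (\<lambda>t. S (2 * int t)) ` {1..2 * q}" by blast
qed auto

text \<open>The indices j and j + q give the two generators of one subgroup, so 2q consecutive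
  indices list every subgroup twice and those below q suffice.\<close>

lemma odd_indices:
  "(\<lambda>j. generate G {S (2 * int j + 1)}) ` {0..2 * q - 1} = (\<lambda>i. generate G {S i}) ` {i. odd i}"
  "(\<lambda>j. generate G {S (2 * int j + 1)}) ` {..<q} = (\<lambda>i. generate G {S i}) ` {i. odd i}"
proof -
  let ?f = "\<lambda>j::nat. generate G {S (2 * int j + 1)}"
  have 1: "?f ` {..<q} \<subseteq> ?f ` {0..2 * q - 1}"
    by (intro image_mono) auto
  have 2: "?f ` {0..2 * q - 1} \<subseteq> (\<lambda>i. generate G {S i}) ` {i. odd i}"
    by auto
  have 3: "(\<lambda>i. generate G {S i}) ` {i. odd i} \<subseteq> ?f ` {..<q}"
  proof
    fix C assume "C \<in> (\<lambda>i. generate G {S i}) ` {i. odd i}"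
    then obtain l where C: "C = generate G {S (2 * l + 1)}" by (auto elim!: oddE)
    \<comment> \<open>The residue of \<open>l\<close> modulo \<open>q\<close> selects the subgroup,
      and the parity of the quotient \<open>d\<close> decides which of its two generators is
      meant.\<close>
    define j where "j = nat (l mod int q)"
    define d where "d = l div int q"
    have j: "int j = l mod int q" "j < q"
      unfolding j_def using q_pos by (simp_all add: nat_less_iff)
    have l: "l = int q * d + int j"
      unfolding d_def j by simp
    have "S (2 * l + 1) \<in> {S (2 * int j + 1), S (2 * int j + 1 + 2 * int q)}"
    proof (cases "even d")
      case True
      then show ?thesis
        by (auto simp: l S_eq_iff elim!: evenE)
    next
      case False
      then obtain b where "d = 2 * b + 1" by (rule oddE)
      then show ?thesis
        by (simp add: l S_eq_iff algebra_simps)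
    qed
    then have "S (2 * l + 1) \<in> cyclic_generators G (?f j)"
      by (simp add: cyclic_generators_S_odd)
    then have "C = ?f j"
      unfolding C cyclic_generators_def by simp
    with j show "C \<in> ?f ` {..<q}" by blast
  qed
  show "?f ` {0..2 * q - 1} = (\<lambda>i. generate G {S i}) ` {i. odd i}"
    by (rule subset_antisym[OF 2 subset_trans[OF 3 1]])
  show "?f ` {..<q} = (\<lambda>i. generate G {S i}) ` {i. odd i}"
    by (rule subset_antisym[OF subset_trans[OF 1 2] 3])
qed

lemma inj_on_even: "inj_on (\<lambda>t. S (2 * int t)) {1..2 * q}"
proof (rule inj_onI)
  fix a b assume ab: "a \<in> {1..2 * q}" "b \<in> {1..2 * q}" and "S (2 * int a) = S (2 * int b)"
  then have "2 * (2 * int q) dvd 2 * (int a - int b)"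
    by (simp add: S_eq_iff algebra_simps)
  then have "2 * int q dvd int a - int b"
    by (simp only: dvd_times_left_cancel_iff)
  moreover have "\<bar>int a - int b\<bar> < 2 * int q"
    using ab by auto
  ultimately show "a = b"
    using dvd_imp_le_int[of "int a - int b" "2 * int q"] by (cases "a = b") auto
qed

text \<open>Equal subgroups have the same generators, so the exponents agree modulo 4q up to a shift
  by 2q; either way q divides a - b.\<close>

lemma inj_on_odd: "inj_on (\<lambda>j. generate G {S (2 * int j + 1)}) {..<q}"
proof (rule inj_onI)
  fix a b assume ab: "a \<in> {..<q}" "b \<in> {..<q}"
    and "generate G {S (2 * int a + 1)} = generate G {S (2 * int b + 1)}"
  then have "cyclic_generators G (generate G {S (2 * int a + 1)}) =
      cyclic_generators G (generate G {S (2 * int b + 1)})"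
    by simp
  then have "S (2 * int a + 1) \<in> {S (2 * int b + 1), S (2 * int b + 1 + 2 * int q)}"
    by (simp add: cyclic_generators_S_odd) blast
  then have "4 * int q dvd 2 * (int a - int b) \<or> 4 * int q dvd 2 * (int a - int b) - 2 * int q"
    by (auto simp: S_eq_iff algebra_simps)
  then have "2 * int q dvd 2 * (int a - int b)"
  proof
    assume "4 * int q dvd 2 * (int a - int b)"
    then show ?thesis
      using dvd_trans[of "2 * int q" "4 * int q"] by simp
  next
    assume "4 * int q dvd 2 * (int a - int b) - 2 * int q"
    then have "2 * int q dvd 2 * (int a - int b) - 2 * int q"
      using dvd_trans[of "2 * int q" "4 * int q"] by simp
    from dvd_add[OF this dvd_refl] show ?thesis by simp
  qed
  then have "int q dvd int a - int b"
    by (simp only: dvd_times_left_cancel_iff)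
  moreover have "\<bar>int a - int b\<bar> < int q"
    using ab by auto
  ultimately show "a = b"
    using dvd_imp_le_int[of "int a - int b" "int q"] by (cases "a = b") auto
qed

end

section \<open>A normal form for the words\<close>

text \<open>The homomorphism to Z/2 that kills r; it will separate s from the powers of r.\<close>

fun word_parity :: "sd_gen word \<Rightarrow> bool" where
  "word_parity [] = False"
| "word_parity ((Gen_s, t) # w) = (\<not> word_parity w)"
| "word_parity ((Gen_r, t) # w) = word_parity w"

text \<open>If \<open>r s = s r\<^sup>c\<close> and \<open>s\<^sup>2 = e\<close>, then \<open>w s\<^sup>b = s\<^sup>a r\<^sup>i\<close> with \<open>i = word_shift c w b\<close> and \<open>a\<close> the parity of
  the left-hand side.\<close>

fun word_shift :: "int \<Rightarrow> sd_gen word \<Rightarrow> bool \<Rightarrow> int" where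
  "word_shift c [] b = 0"
| "word_shift c ((Gen_s, t) # w) b = word_shift c w b"
| "word_shift c ((Gen_r, t) # w) b =
    word_shift c w b + (if t then 1 else -1) * (if b \<noteq> word_parity w then c else 1)"

lemma word_parity_append: "word_parity (v @ w) \<longleftrightarrow> word_parity v \<noteq> word_parity w"
  by (induction v rule: word_parity.induct) auto

text \<open>The letters s of \<open>w\<close> stand to the right of \<open>v\<close>, so an odd
  \<open>w\<close> flips the argument at which the shift of \<open>v\<close> is read. This cocycle
  rule is the reason for the argument \<open>b\<close>.\<close>

lemma word_shift_append:
  "word_shift c (v @ w) b = word_shift c w b + word_shift c v (b \<noteq> word_parity w)"
  by (induction v rule: word_parity.induct) (auto simp: word_parity_append)

lemma word_parity_replicate_r: "\<not> word_parity (replicate m (Gen_r, t))"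
  by (induction m) auto

lemma word_shift_replicate_r:
  "word_shift c (replicate m (Gen_r, True)) b = int m * (if b then c else 1)"
  by (induction m) (auto simp: word_parity_replicate_r algebra_simps)

text \<open>Invariance is proved for all \<open>b\<close> at once because concatenation reads the
  shift of the left factor at an argument altered by the right one.\<close>

lemma word_cong_invariants:
  fixes n :: int
  assumes "word_cong rels v w"
    and "\<And>v w. (v, w) \<in> rels \<Longrightarrow> word_parity v = word_parity w"
    and "\<And>v w b. (v, w) \<in> rels \<Longrightarrow> n dvd word_shift c v b - word_shift c w b"
  shows "word_parity v = word_parity w \<and> (\<forall>b. n dvd word_shift c v b - word_shift c w b)"
  using assms(1)
proof (induction rule: word_cong.induct)
  case (relation v w)
  then show ?case using assms(2,3) by blast
next
  case (cancel x b)
  \<comment> \<open>Two letters s flip the parity twice; two opposite letters r see the same letters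
    s to their right, so their contributions cancel.\<close>
  then show ?case by (cases x) auto
next
  case (sym v w)
  then show ?case by (metis dvd_diff_commute)
next
  case (trans u v w)
  have "n dvd (word_shift c u b - word_shift c v b) + (word_shift c v b - word_shift c w b)" for b
    using trans by (intro dvd_add) auto
  then show ?case using trans by simp
next
  case (append v v' w w')
  have "(a + b) - (a' + b') = (a - a') + (b - b')" for a b a' b' :: int
    by simp
  with append show ?case
    by (auto simp only: word_parity_append word_shift_append intro!: dvd_add)
qed simp

section \<open>From the presentation to the semidihedral structure\<close>

lemma presented_gen_closed: "presented_gen rels x \<in> carrier (presented_group rels)"
  by (simp add: presented_gen_def presented_group_def)

lemma presented_gen_pow:
  "presented_gen rels x [^]\<^bsub>presented_group rels\<^esub> (m::nat) =
    word_class rels (replicate m (x, True))"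
proof -
  interpret group "presented_group rels" by (rule group_presented_group)
  show ?thesis
  proof (induction m)
    case 0
    then show ?case by (simp add: presented_group_def)
  next
    case (Suc m)
    then show ?case
      by (simp add: presented_gen_def presented_group_mult replicate_append_same
          flip: replicate_Suc)
  qed
qed

lemma presented_gen_inv:
  "inv\<^bsub>presented_group rels\<^esub> presented_gen rels x = word_class rels [(x, False)]"
proof -
  interpret group "presented_group rels" by (rule group_presented_group)
  have "word_class rels [(x, False)] \<otimes>\<^bsub>presented_group rels\<^esub> presented_gen rels x =
      \<one>\<^bsub>presented_group rels\<^esub>"
    using word_cong.cancel[of rels x False]
    by (simp add: presented_gen_def presented_group_mult word_class_eq_iff)
      (simp add: presented_group_def word_class_eq_iff)
  then show ?thesis
    by (rule inv_equality) (simp_all add: presented_gen_closed, simp add: presented_group_def)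
qed

text \<open>The relations bring every element into a normal form, which leaves at most 8q elements;
  the two invariants show that these are distinct.\<close>

lemma semidihedral_sd_group:
  assumes k: "k \<ge> 2" and p: "p > 0"
  shows "semidihedral (sd_group k p) (2 ^ (k - 2) * p) (sd_s k p) (sd_r k p)"
proof -
  let ?rels = "sd_rels k p"
  let ?G = "sd_group k p"
  let ?s = "sd_s k p" and ?r = "sd_r k p"
  define q where "q = 2 ^ (k - 2) * p"
  interpret group ?G by (rule group_presented_group)
  have q: "q > 0"
    using p by (simp add: q_def)
  have "2 ^ (k - 1) * p = 2 * q \<and> 2 ^ k * p = 4 * q"
    using k by (cases k; cases "k - 1") (auto simp: q_def)
  then have rels: "?rels =
      {(replicate (4 * q) (Gen_r, True), []), (replicate 2 (Gen_s, True), []),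
       ([(Gen_s, True), (Gen_r, True), (Gen_s, False)], replicate (2 * q - 1) (Gen_r, True))}"
    by (simp add: sd_rels_def)
  define c where "c = 2 * int q - 1"
  have c: "int (2 * q - 1) = c"
    using q by (simp add: c_def)
  \<comment> \<open>The difference is 4q(1-q). The conjugation relation needs this at
    \<open>b = True\<close>, where its two sides have shifts 1 and c * c.\<close>
  have c2: "4 * int q dvd 1 - c * c"
    by (rule dvdI[of _ _ "1 - int q"]) (simp add: c_def algebra_simps)
  have two: "replicate 2 x = [x, x]" for x :: "sd_gen \<times> bool"
    by (simp add: numeral_2_eq_2)
  have inv: "word_parity v = word_parity w \<and>
      4 * int q dvd word_shift c v False - word_shift c w False"
    if "word_class ?rels v = word_class ?rels w" for v w
  proof -
    have "word_parity v = word_parity w \<and>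
        (\<forall>b. 4 * int q dvd word_shift c v b - word_shift c w b)"
    proof (rule word_cong_invariants)
      show "word_cong ?rels v w"
        using that by (simp add: word_class_eq_iff)
      show "word_parity v = word_parity w" if "(v, w) \<in> ?rels" for v w
        using that by (auto simp: rels word_parity_replicate_r two)
      show "4 * int q dvd word_shift c v b - word_shift c w b" if "(v, w) \<in> ?rels" for v w b
        using that c2
        by (auto simp: rels word_shift_replicate_r word_parity_replicate_r two c[unfolded One_nat_def])
    qed
    then show ?thesis by blast
  qed
  have "word_class ?rels v = word_class ?rels w" if "(v, w) \<in> ?rels" for v w
    using that by (simp add: word_class_eq_iff word_cong.relation)
  then have rel:
    "word_class ?rels (replicate (4 * q) (Gen_r, True)) = word_class ?rels []"
    "word_class ?rels [(Gen_s, True), (Gen_s, True)] = word_class ?rels []"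
    "word_class ?rels [(Gen_s, True), (Gen_r, True), (Gen_s, False)] =
      word_class ?rels (replicate (2 * q - 1) (Gen_r, True))"
    by (simp_all add: rels two)
  have [simp]: "?r \<in> carrier ?G" "?s \<in> carrier ?G"
    by (rule presented_gen_closed)+
  have one: "\<one>\<^bsub>?G\<^esub> = word_class ?rels []"
    by (simp add: presented_group_def)
  have r_n: "?r [^]\<^bsub>?G\<^esub> (4 * int q) = \<one>\<^bsub>?G\<^esub>"
    using int_pow_int[of ?G ?r "4 * q"] by (simp add: presented_gen_pow one rel(1))
  \<comment> \<open>Every power of r becomes the class of a word in fewer than 4q positive letters,
    on which the invariants can be evaluated.\<close>
  have r_mod: "?r [^]\<^bsub>?G\<^esub> i = word_class ?rels (replicate (nat (i mod (4 * int q))) (Gen_r, True))"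
    for i :: int
  proof -
    have "?r [^]\<^bsub>?G\<^esub> i = ?r [^]\<^bsub>?G\<^esub> (4 * int q * (i div (4 * int q)) + i mod (4 * int q))"
      by simp
    also have "\<dots> = ?r [^]\<^bsub>?G\<^esub> (4 * int q * (i div (4 * int q))) \<otimes>\<^bsub>?G\<^esub> ?r [^]\<^bsub>?G\<^esub> (i mod (4 * int q))"
      by (simp only: int_pow_mult \<open>?r \<in> carrier ?G\<close>)
    also have "?r [^]\<^bsub>?G\<^esub> (4 * int q * (i div (4 * int q))) = \<one>\<^bsub>?G\<^esub>"
      using int_pow_pow[of ?r "4 * int q" "i div (4 * int q)"] r_n by simp
    also have "?r [^]\<^bsub>?G\<^esub> (i mod (4 * int q)) = ?r [^]\<^bsub>?G\<^esub> nat (i mod (4 * int q))"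
      using q by (simp add: pow_nat)
    finally show ?thesis
      by (simp add: presented_gen_pow[symmetric])
  qed
  have s_s: "?s \<otimes>\<^bsub>?G\<^esub> ?s = \<one>\<^bsub>?G\<^esub>"
    by (simp add: presented_gen_def presented_group_mult one rel(2))
  then have inv_s: "inv\<^bsub>?G\<^esub> ?s = ?s"
    by (intro inv_equality) simp_all
  have "?s \<otimes>\<^bsub>?G\<^esub> ?r \<otimes>\<^bsub>?G\<^esub> inv\<^bsub>?G\<^esub> ?s = ?r [^]\<^bsub>?G\<^esub> c"
    unfolding presented_gen_inv c[symmetric] int_pow_int presented_gen_pow
    by (simp add: presented_gen_def presented_group_mult rel(3)[unfolded One_nat_def])
  then have "?s \<otimes>\<^bsub>?G\<^esub> (?s \<otimes>\<^bsub>?G\<^esub> ?r \<otimes>\<^bsub>?G\<^esub> ?s) = ?s \<otimes>\<^bsub>?G\<^esub> ?r [^]\<^bsub>?G\<^esub> c"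
    by (simp add: inv_s)
  then have r_s: "?r \<otimes>\<^bsub>?G\<^esub> ?s = ?s \<otimes>\<^bsub>?G\<^esub> ?r [^]\<^bsub>?G\<^esub> c"
    by (simp add: s_s flip: m_assoc)
  \<comment> \<open>The same rule for the inverse of r, since words contain formal inverses.\<close>
  have r_s': "inv\<^bsub>?G\<^esub> ?r \<otimes>\<^bsub>?G\<^esub> ?s = ?s \<otimes>\<^bsub>?G\<^esub> ?r [^]\<^bsub>?G\<^esub> (- c)"
  proof -
    have "?r \<otimes>\<^bsub>?G\<^esub> (?s \<otimes>\<^bsub>?G\<^esub> ?r [^]\<^bsub>?G\<^esub> (- c)) = ?s"
      by (simp add: r_s m_assoc flip: m_assoc[of ?r] int_pow_mult)
    then show ?thesis
      by (metis inv_solve_left' int_pow_closed m_closed \<open>?r \<in> carrier ?G\<close> \<open>?s \<in> carrier ?G\<close>)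
  qed
  \<comment> \<open>The elements r^i and s r^i include the identity and are closed under left
    multiplication by s, r and the inverse of r. As s is its own inverse, this covers every
    letter.\<close>
  have norm: "\<exists>i :: int. word_class ?rels w = ?r [^]\<^bsub>?G\<^esub> i \<or>
      word_class ?rels w = ?s \<otimes>\<^bsub>?G\<^esub> ?r [^]\<^bsub>?G\<^esub> i" for w
  proof (induction w)
    case Nil
    then show ?case by (metis int_pow_0 one)
  next
    case (Cons a w)
    obtain x t where a: "a = (x, t)" by (cases a)
    define g where "g = word_class ?rels [a]"
    have split: "word_class ?rels (a # w) = g \<otimes>\<^bsub>?G\<^esub> word_class ?rels w"
      by (simp add: presented_group_mult g_def)
    have "g = ?s \<or> g = ?r \<or> g = inv\<^bsub>?G\<^esub> ?r"
      unfolding g_def a using presented_gen_inv[of ?rels x] inv_s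
      by (cases x; cases t) (auto simp: presented_gen_def)
    moreover from Cons obtain i :: int where
      "word_class ?rels w = ?r [^]\<^bsub>?G\<^esub> i \<or> word_class ?rels w = ?s \<otimes>\<^bsub>?G\<^esub> ?r [^]\<^bsub>?G\<^esub> i" by blast
    moreover have "?r \<otimes>\<^bsub>?G\<^esub> ?r [^]\<^bsub>?G\<^esub> i = ?r [^]\<^bsub>?G\<^esub> (1 + i)"
      "inv\<^bsub>?G\<^esub> ?r \<otimes>\<^bsub>?G\<^esub> ?r [^]\<^bsub>?G\<^esub> i = ?r [^]\<^bsub>?G\<^esub> (- 1 + i)"
      by (simp_all only: int_pow_mult int_pow_neg int_pow_1 \<open>?r \<in> carrier ?G\<close>)
    moreover have "?s \<otimes>\<^bsub>?G\<^esub> (?s \<otimes>\<^bsub>?G\<^esub> ?r [^]\<^bsub>?G\<^esub> i) = ?r [^]\<^bsub>?G\<^esub> i"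
      by (simp add: s_s flip: m_assoc)
    moreover have "?r \<otimes>\<^bsub>?G\<^esub> (?s \<otimes>\<^bsub>?G\<^esub> ?r [^]\<^bsub>?G\<^esub> i) = ?s \<otimes>\<^bsub>?G\<^esub> ?r [^]\<^bsub>?G\<^esub> (c + i)"
      by (simp add: r_s int_pow_mult m_assoc flip: m_assoc[of ?r])
    moreover have "inv\<^bsub>?G\<^esub> ?r \<otimes>\<^bsub>?G\<^esub> (?s \<otimes>\<^bsub>?G\<^esub> ?r [^]\<^bsub>?G\<^esub> i) = ?s \<otimes>\<^bsub>?G\<^esub> ?r [^]\<^bsub>?G\<^esub> (- c + i)"
      using int_pow_mult[of ?r "- c" i]
      by (simp add: r_s' m_assoc flip: m_assoc[of "inv\<^bsub>?G\<^esub> ?r"])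
    ultimately show ?case
      unfolding split by metis
  qed
  show ?thesis
    unfolding q_def[symmetric]
  proof unfold_locales
    show "?r [^]\<^bsub>?G\<^esub> i = ?r [^]\<^bsub>?G\<^esub> j \<longleftrightarrow> 4 * int q dvd i - j" for i j :: int
    proof
      assume "?r [^]\<^bsub>?G\<^esub> i = ?r [^]\<^bsub>?G\<^esub> j"
      \<comment> \<open>At \<open>b = False\<close> the shift of a word of m letters r is m, so it
        recovers the exponent.\<close>
      then have "4 * int q dvd i mod (4 * int q) - j mod (4 * int q)"
        unfolding r_mod using q by (auto dest: inv simp: word_shift_replicate_r)
      then show "4 * int q dvd i - j"
        by (simp add: mod_diff_eq flip: mod_eq_0_iff_dvd)
    next
      assume "4 * int q dvd i - j"
      then show "?r [^]\<^bsub>?G\<^esub> i = ?r [^]\<^bsub>?G\<^esub> j"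
        unfolding r_mod by (simp flip: mod_eq_dvd_iff)
    qed
    show "?s \<noteq> ?r [^]\<^bsub>?G\<^esub> i" for i :: int
      unfolding r_mod by (auto dest: inv simp: presented_gen_def word_parity_replicate_r)
    show "\<exists>i :: int. x = ?r [^]\<^bsub>?G\<^esub> i \<or> x = ?s \<otimes>\<^bsub>?G\<^esub> ?r [^]\<^bsub>?G\<^esub> i" if "x \<in> carrier ?G" for x
      using that norm by (auto simp: presented_group_def)
  qed (use q s_s r_s in \<open>simp_all add: c_def\<close>)
qed

section \<open>Assembly of the decomposition from even and odd exponents\<close>

theorem mainTheorem1:
  fixes k p :: nat
    and G :: "sd_gen word set monoid"
    and s r u :: "sd_gen word set"
    and P_r P_u :: "sd_gen word set graph"
    and \<C> :: "sd_gen word set set set"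
    and \<E> \<J> :: "sd_gen word set graph set"
  assumes "k \<ge> 2" and "Factorial_Ring.prime p" and "odd p"
    and "G = sd_group k p" and "s = sd_s k p" and "r = sd_r k p"
    and "u = r [^]\<^bsub>G\<^esub> (2 ^ (k - 1) * p)"
    and "P_r = power_graph (G\<lparr>carrier := cyclic_subgroup G r\<rparr>)"
    and "P_u = power_graph (G\<lparr>carrier := cyclic_subgroup G u\<rparr>)"
    and "\<E> = (\<lambda>t. complete_graph {\<one>\<^bsub>G\<^esub>, s \<otimes>\<^bsub>G\<^esub> r [^]\<^bsub>G\<^esub> (2 * t)}) ` {1..2 ^ (k - 1) * p}"
    and "\<C> = (\<lambda>j. cyclic_subgroup G (s \<otimes>\<^bsub>G\<^esub> r [^]\<^bsub>G\<^esub> (2 * j + 1))) ` {0..2 ^ (k - 1) * p - 1}"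
    and "\<J> = (\<lambda>C. graph_join P_u (complete_graph (cyclic_generators G C))) ` \<C>"
  shows "power_graph G = graph_union P_r (graph_union (graph_Union \<E>) (graph_Union \<J>)) \<and>
    graph_iso P_r (power_graph (integer_mod_group (2 ^ k * p))) \<and>
    are_copies (2 ^ (k - 1) * p) (K 2) \<E> \<and>
    card \<C> = 2 ^ (k - 2) * p \<and>
    (\<forall>C\<in>\<C>. card C = 4 \<and> card (cyclic_generators G C) = 2 \<and>
      verts P_u \<inter> cyclic_generators G C = {}) \<and>
    verts P_u = {\<one>\<^bsub>G\<^esub>, u} \<and> u \<noteq> \<one>\<^bsub>G\<^esub> \<and>
    are_copies (2 ^ (k - 2) * p) (graph_sum_join P_u (K 2)) \<J>"
proof -
  define q where "q = 2 ^ (k - 2) * p"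
  have p: "p > 0"
    using assms(2) prime_gt_0_nat by blast
  have q: "2 ^ (k - 2) * p = q" "2 ^ (k - 1) * p = 2 * q" "2 ^ k * p = 4 * q"
    using assms(1) by (cases k; cases "k - 1"; auto simp: q_def)+
  interpret semidihedral G q s r
    unfolding assms(4-6) q_def using assms(1) p by (rule semidihedral_sd_group)
  have u: "u = R (2 * int q)"
    unfolding assms(7) q by (simp add: nat_pow_r)
  have P_u: "P_u = complete_graph {\<one>\<^bsub>G\<^esub>, u}"
    unfolding assms(9) u by (rule power_graph_u)
  have u1: "u \<noteq> \<one>\<^bsub>G\<^esub>"
    unfolding u by (rule u_neq_one)
  have uS: "S i \<noteq> \<one>\<^bsub>G\<^esub>" "S i \<noteq> u" for i
    using S_neq_R R_0 u by metis+
  \<comment> \<open>The form over 1..2q serves for counting, and the form over all even exponents,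
    reached below, for the union.\<close>
  have \<E>: "\<E> = complete_graph ` (\<lambda>t. {\<one>\<^bsub>G\<^esub>, S (2 * int t)}) ` {1..2 * q}"
    unfolding assms(10) q nat_pow_r by (simp add: image_image S_def R_def)
  also have "\<dots> = (\<lambda>x. complete_graph {\<one>\<^bsub>G\<^esub>, x}) ` S ` {i. even i}"
    unfolding even_indices[symmetric] by (simp add: image_image)
  also have "\<dots> = (\<lambda>i. complete_graph (generate G {S i})) ` {i. even i}"
    by (auto simp: image_image generate_S_even)
  finally have \<E>': "\<E> = (\<lambda>i. complete_graph (generate G {S i})) ` {i. even i}" .
  have \<C>: "\<C> = (\<lambda>j. generate G {S (2 * int j + 1)}) ` {0..2 * q - 1}"
    unfolding assms(11) q nat_pow_r by (simp add: S_def R_def add.commute)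
  have \<C>_odd: "\<C> = (\<lambda>i. generate G {S i}) ` {i. odd i}"
    unfolding \<C> by (rule odd_indices)
  \<comment> \<open>Without the repetitions the indexing is injective, so the subgroups can be
    counted.\<close>
  then have \<C>_q: "\<C> = (\<lambda>j. generate G {S (2 * int j + 1)}) ` {..<q}"
    by (simp only: odd_indices(2))
  have card_\<C>: "card \<C> = q" "finite \<C>"
    unfolding \<C>_q using card_image[OF inj_on_odd] by simp_all
  have C: "card C = 4 \<and> card (cyclic_generators G C) = 2 \<and>
      verts P_u \<inter> cyclic_generators G C = {} \<and>
      C = {\<one>\<^bsub>G\<^esub>, u} \<union> cyclic_generators G C" if mem: "C \<in> \<C>" for C
  proof -
    obtain i where i: "odd i" "C = generate G {S i}"
      using mem unfolding \<C>_odd by auto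
    have "S (i + 2 * int q) \<noteq> S i"
      using not_dvd_half by (simp add: S_eq_iff)
    with u1 uS[of i] uS[of "i + 2 * int q"] show ?thesis
      unfolding P_u i(2) cyclic_generators_S_odd[OF i(1)] unfolding generate_S_odd[OF i(1)] u
      by (auto simp: card_insert_if)
  qed
  \<comment> \<open>Each \<open>C\<close> is the disjoint union of {e, u} and its two generators, so
    the join is the complete graph on \<open>C\<close>.\<close>
  have \<J>: "\<J> = complete_graph ` \<C>"
    unfolding assms(12) P_u
  proof (rule image_cong)
    fix C assume "C \<in> \<C>"
    from C[OF this] show "graph_join (complete_graph {\<one>\<^bsub>G\<^esub>, u})
        (complete_graph (cyclic_generators G C)) = complete_graph C"
      unfolding P_u by (metis graph_join_complete_graph verts_complete_graph)
  qed simp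
  have union: "power_graph G = graph_union P_r (graph_union (graph_Union \<E>) (graph_Union \<J>))"
  proof (rule graph.equality)
    \<comment> \<open>An edge not in \<open>P_r\<close> lies in the clique of some
      \<open>S i\<close>, and the parity of \<open>i\<close> decides to which family that clique
      belongs.\<close>
    have "edges (power_graph G) = edges P_r \<union>
        ((\<Union>i\<in>{i. even i}. edges (complete_graph (generate G {S i}))) \<union>
         (\<Union>i\<in>{i. odd i}. edges (complete_graph (generate G {S i}))))"
      unfolding edges_power_graph_semidihedral assms(8) by blast
    also have "\<dots> = edges (graph_union P_r (graph_union (graph_Union \<E>) (graph_Union \<J>)))"
      unfolding \<E>' \<J> \<C>_odd by (simp add: graph_union_def graph_Union_def image_image)
    finally show "edges (power_graph G) = \<dots>" .
    have gen: "generate G {S i} \<subseteq> carrier G" "S i \<in> generate G {S i}" for i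
      using generate_incl[of "{S i}"] by (simp_all add: generate.incl)
    have "carrier G = range R \<union> (\<Union>i. generate G {S i})"
    proof (rule subset_antisym)
      show "carrier G \<subseteq> range R \<union> (\<Union>i. generate G {S i})"
        using gen(2) unfolding carrier_eq by fastforce
      show "range R \<union> (\<Union>i. generate G {S i}) \<subseteq> carrier G"
        using gen(1) R_closed by auto
    qed
    also have "(\<Union>i. generate G {S i}) =
        (\<Union>i\<in>{i. even i}. generate G {S i}) \<union> (\<Union>i\<in>{i. odd i}. generate G {S i})"
      by auto
    finally show "verts (power_graph G) =
        verts (graph_union P_r (graph_union (graph_Union \<E>) (graph_Union \<J>)))"
      unfolding \<E>' \<J> \<C>_odd assms(8)
      by (simp add: graph_union_def graph_Union_def image_image generate_r)
  qed simp
  have "inj_on (\<lambda>t. {\<one>\<^bsub>G\<^esub>, S (2 * int t)}) {1..2 * q}"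
  proof (rule inj_onI)
    fix a b assume ab: "a \<in> {1..2 * q}" "b \<in> {1..2 * q}"
      and "{\<one>\<^bsub>G\<^esub>, S (2 * int a)} = {\<one>\<^bsub>G\<^esub>, S (2 * int b)}"
    then have "S (2 * int a) = S (2 * int b)"
      using uS(1) unfolding doubleton_eq_iff by metis
    then show "a = b"
      by (rule inj_onD[OF inj_on_even _ ab])
  qed
  then have "card \<E> = 2 * q"
    unfolding \<E> by (simp add: card_image inj_complete_graph)
  moreover have "graph_iso \<Delta> (K 2)" if mem: "\<Delta> \<in> \<E>" for \<Delta>
  proof -
    obtain t :: nat where \<Delta>: "\<Delta> = complete_graph {\<one>\<^bsub>G\<^esub>, S (2 * int t)}"
      using mem unfolding \<E> by auto
    show ?thesis
      unfolding \<Delta> using uS(1)[of "2 * int t"] by (intro graph_iso_complete_graph) auto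
  qed
  ultimately have copies_\<E>: "are_copies (2 * q) (K 2) \<E>"
    by (simp add: are_copies_def \<E>)
  have "graph_iso \<Delta> (graph_sum_join P_u (K 2))" if mem: "\<Delta> \<in> \<J>" for \<Delta>
  proof -
    obtain C where "C \<in> \<C>" and \<Delta>: "\<Delta> = complete_graph C"
      using mem unfolding \<J> by auto
    then have "card C = 4"
      using C by blast
    \<comment> \<open>The abstract join lives on a disjoint sum that also has four vertices, so both
      graphs are copies of \<open>K 4\<close>.\<close>
    moreover have "card ({\<one>\<^bsub>G\<^esub>, u} <+> {..<2::nat}) = 4"
      using u1 by (simp add: card_Plus)
    ultimately show ?thesis
      unfolding \<Delta> P_u graph_sum_join_complete_graph
      by (intro graph_iso_complete_graph) (simp_all add: card_ge_0_finite)
  qed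
  then have copies_\<J>: "are_copies q (graph_sum_join P_u (K 2)) \<J>"
    unfolding are_copies_def \<J> using card_\<C> by (simp add: card_image inj_complete_graph)
  show ?thesis
    unfolding q
    using union graph_iso_power_graph_r copies_\<E> copies_\<J> card_\<C> C u1 P_u
    by (simp add: assms(8))
qed

end
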